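(* Let $\mathcal{B}\subseteq\mathbb{N}$ be a non-empty primitive set. Then $X_{\mathcal{E}}$ is the unique minimal subset of $X_\varphi$ (and hence also of $X_\eta$) with respect to the left shift.
   Context: $\mathbb{N}=\{1,2,\dots\}$. A set $\mathcal{B}\subseteq\mathbb{N}$ is primitive if there are no distinct $b,b'\in\mathcal{B}$ with $b\mid b'$. For $\mathcal{A}\subseteq\mathbb{N}$ let $\mathcal{M}_{\mathcal{A}}:=\bigcup_{a\in\mathcal{A}}a\mathbb{Z}$ and $\mathcal{F}_{\mathcal{A}}:=\mathbb{Z}\setminus\mathcal{M}_{\mathcal{A}}$. For finite $S\subseteq\mathcal{B}$ let $\mathcal{A}_S:=\{\gcd(b,\operatorname{lcm}(S)):b\in\mathcal{B}\}$ (with $\operatorname{lcm}(\emptyset)=1$), and let $\mathcal{E}:=\bigcup_{S\subseteq\mathcal{B},\,S\text{ finite}}\mathcal{F}_{\mathcal{A}_S}$. $X_{\mathcal{E}}$ denotes the orbit closure in $\{0,1\}^{\mathbb{Z}}$ (under the left shift) of the characteristic function $1_{\mathcal{E}}\in\{0,1\}^{\mathbb{Z}}$. Let $\Delta:\mathbb{Z}\to\prod_{b\in\mathcal{B}}\mathbb{Z}/b\mathbb{Z}$, $\Delta(n)=(n,n,\dots)$, be the canonical diagonal embedding (the product carries the product topology of discrete finite groups), and let $H:=\overline{\Delta(\mathbb{Z})}$, a compact abelian group. The window is $W:=\{h\in H: h_b\neq 0\ \text{for all } b\in\mathcal{B}\}$. The coding function $\varphi:H\to\{0,1\}^{\mathbb{Z}}$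 is defined by $\varphi(h)(n)=1$ if and only if $h+\Delta(n)\in W$. Let $\eta:=\varphi(\Delta(0))$ (the characteristic function of $\mathcal{F}_{\mathcal{B}}$), $X_\eta:=\overline{\varphi(\Delta(\mathbb{Z}))}$ (the orbit closure of $\eta$ under the left shift), and $X_\varphi:=\overline{\varphi(H)}$. A minimal subset is a non-empty closed shift-invariant subset containing no proper non-empty closed shift-invariant subset. *)

theory Defs
  imports "HOL-Analysis.Analysis" "HOL-Algebra.Elementary_Groups" "HOL-Algebra.Product_Groups"
begin

section \<open>The two-sided full shift on the symbols 0 and 1\<close>

definition full_shift :: "(int \<Rightarrow> nat) topology" where
  "full_shift = product_topology (\<lambda>_. discrete_topology {0, 1}) UNIV"

definition shift_by :: "int \<Rightarrow> (int \<Rightarrow> nat) \<Rightarrow> (int \<Rightarrow> nat)" where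
  "shift_by k x = (\<lambda>n. x (n + k))"

definition left_shift :: "(int \<Rightarrow> nat) \<Rightarrow> (int \<Rightarrow> nat)" where
  "left_shift = shift_by 1"

definition orbit_closure :: "(int \<Rightarrow> nat) \<Rightarrow> (int \<Rightarrow> nat) set" where
  "orbit_closure x = full_shift closure_of (range (\<lambda>k. shift_by k x))"

text \<open>The left shift is a homeomorphism of the full shift, and invariance means that a set
  is mapped onto itself, i.e. it is invariant under the generated action of the integers.\<close>

definition closed_invariant :: "(int \<Rightarrow> nat) set \<Rightarrow> bool" where
  "closed_invariant Y \<longleftrightarrow> closedin full_shift Y \<and> left_shift ` Y = Y"

definition minimal_subset :: "(int \<Rightarrow> nat) set \<Rightarrow> (int \<Rightarrow> nat) set \<Rightarrow> bool" where
  "minimal_subset X Y \<longleftrightarrow>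
     Y \<subseteq> X \<and> Y \<noteq> {} \<and> closed_invariant Y \<and>
     \<not> (\<exists>Z. Z \<noteq> {} \<and> closed_invariant Z \<and> Z \<subset> Y)"

definition unique_minimal_subset :: "(int \<Rightarrow> nat) set \<Rightarrow> (int \<Rightarrow> nat) set \<Rightarrow> bool" where
  "unique_minimal_subset X Y \<longleftrightarrow>
     minimal_subset X Y \<and> (\<forall>Y'. minimal_subset X Y' \<longrightarrow> Y' = Y)"


section \<open>Sets of multiples\<close>

definition primitive :: "nat set \<Rightarrow> bool" where
  "primitive B \<longleftrightarrow> \<not> (\<exists>b\<in>B. \<exists>b'\<in>B. b \<noteq> b' \<and> b dvd b')"

definition multiples :: "nat set \<Rightarrow> int set" where
  "multiples A = (\<Union>a\<in>A. range (\<lambda>k. int a * k))"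

definition free_set :: "nat set \<Rightarrow> int set" where
  "free_set A = - multiples A"

definition gcd_set :: "nat set \<Rightarrow> nat set \<Rightarrow> nat set" where
  "gcd_set B S = (\<lambda>b. gcd b (Lcm S)) ` B"

definition E_set :: "nat set \<Rightarrow> int set" where
  "E_set B = (\<Union>S\<in>{S. S \<subseteq> B \<and> finite S}. free_set (gcd_set B S))"

definition X_E :: "nat set \<Rightarrow> (int \<Rightarrow> nat) set" where
  "X_E B = orbit_closure (indicator (E_set B))"


section \<open>The compact group, the window and the coding function\<close>

text \<open>For \<open>b \<ge> 1\<close> the cyclic group of order \<open>b\<close> is represented by the residues
  \<open>{0..<int b}\<close> with addition modulo \<open>b\<close>; elements of the product over \<open>B\<close> are functions
  that are \<open>undefined\<close> outside \<open>B\<close>. The group operation of \<open>residue_product\<close> is the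
  componentwise addition, although it is written multiplicatively.\<close>

abbreviation residue_product :: "nat set \<Rightarrow> (nat \<Rightarrow> int) monoid" where
  "residue_product B \<equiv> product_group B integer_mod_group"

definition residue_product_topology :: "nat set \<Rightarrow> (nat \<Rightarrow> int) topology" where
  "residue_product_topology B =
     product_topology (\<lambda>b. discrete_topology (carrier (integer_mod_group b))) B"

definition diag :: "nat set \<Rightarrow> int \<Rightarrow> (nat \<Rightarrow> int)" where
  "diag B n = (\<lambda>b\<in>B. n mod int b)"

definition H_group :: "nat set \<Rightarrow> (nat \<Rightarrow> int) set" where
  "H_group B = residue_product_topology B closure_of (range (diag B))"

definition window :: "nat set \<Rightarrow> (nat \<Rightarrow> int) set" where
  "window B = {h \<in> H_group B. \<forall>b\<in>B. h b \<noteq> 0}"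

definition coding :: "nat set \<Rightarrow> (nat \<Rightarrow> int) \<Rightarrow> (int \<Rightarrow> nat)" where
  "coding B h = (\<lambda>n. if h \<otimes>\<^bsub>residue_product B\<^esub> diag B n \<in> window B then 1 else 0)"

definition X_eta :: "nat set \<Rightarrow> (int \<Rightarrow> nat) set" where
  "X_eta B = full_shift closure_of (coding B ` range (diag B))"

definition X_phi :: "nat set \<Rightarrow> (int \<Rightarrow> nat) set" where
  "X_phi B = full_shift closure_of (coding B ` H_group B)"

end

theory Submission
  imports Defs
begin

text \<open>
  The orbit closure \<open>X_E\<close> is the unique minimal set as soon as the point \<open>1_E\<close> lies in the orbit
  closure of every point of \<open>X_phi\<close>: then every non-empty closed invariant subset of \<open>X_phi\<close>
  contains \<open>X_E\<close>. Since \<open>X_eta\<close> is the orbit closure of the point \<open>\<eta> = \<phi>(\<Delta>(0))\<close> of \<open>X_phi\<close>, this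
  also gives \<open>X_E \<subseteq> X_eta \<subseteq> X_phi\<close>, so that \<open>X_E\<close> itself is one of those subsets.

  To find \<open>1_E\<close> near the orbit of \<open>x \<in> X_phi\<close>, it suffices to see each central block of \<open>1_E\<close> in
  every \<open>\<phi>(h)\<close> with \<open>h \<in> H\<close> at a place \<open>k\<close> bounded independently of \<open>h\<close>; such a uniform statement
  only involves finitely many coordinates of \<open>\<phi>(h)\<close>, and therefore survives the passage to the
  closure (\<open>orbit_closure_if_uniformly_visible\<close>).

  The place \<open>k\<close> is found by the Chinese remainder theorem (\<open>E_block_uniformly_visible\<close>). Let \<open>S\<close> be
  finite. If \<open>k\<close> is chosen with \<open>h_b + k \<equiv> 0\<close> modulo all \<open>b \<in> S\<close>, then for every \<open>b \<in> B\<close> the number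
  \<open>h_b + k\<close> is divisible by \<open>gcd b (Lcm S)\<close>, because \<open>h\<close> is a limit of diagonal points. Hence
  \<open>\<phi>(h)\<close> is automatically \<open>1\<close> at \<open>n + k\<close> for \<open>n \<in> F(A_S)\<close>, and for large \<open>S\<close> these are all the
  elements of \<open>E\<close> in the block. What remains is to produce zeros at \<open>n + k\<close> for the finitely many
  other \<open>n\<close> of the block. Such an \<open>n\<close> is a multiple of some \<open>c\<close> that is approximated by
  \<open>B\<close> in the sense that every finite \<open>S'\<close> admits \<open>b \<in> B\<close> with \<open>gcd b (Lcm S')\<close> dividing \<open>c\<close>
  (\<open>persistent_divisor_of_non_E\<close>). Enlarge \<open>S\<close> so that \<open>c\<close> divides \<open>Lcm S\<close>, and let \<open>S'\<close> consist
  of \<open>S\<close> and the moduli already used for earlier zeros. Then \<open>b\<close> imposes the congruence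
  \<open>k \<equiv> - h_b - n\<close> modulo \<open>b\<close>, and it is compatible with those modulo the elements of \<open>S'\<close>, because
  \<open>gcd b (Lcm S')\<close> divides both \<open>n\<close> and \<open>h_b + k\<close> (\<open>prescribe_zeros\<close>).
\<close>

section \<open>Closures in products of discrete spaces\<close>

lemma closure_of_product_discrete_iff:
  assumes "A \<subseteq> Pi\<^sub>E I U"
  shows "x \<in> product_topology (\<lambda>i. discrete_topology (U i)) I closure_of A \<longleftrightarrow>
    x \<in> Pi\<^sub>E I U \<and> (\<forall>F. finite F \<and> F \<subseteq> I \<longrightarrow> (\<exists>a\<in>A. \<forall>i\<in>F. a i = x i))"
    (is "?L \<longleftrightarrow> ?R")
proof
  assume L: ?L
  then have x: "x \<in> Pi\<^sub>E I U"
    by (auto simp: in_closure_of)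
  have "\<exists>a\<in>A. \<forall>i\<in>F. a i = x i" if F: "finite F" "F \<subseteq> I" for F
  proof -
    let ?T = "Pi\<^sub>E I (\<lambda>i. if i \<in> F then {x i} else U i)"
    have "openin (product_topology (\<lambda>i. discrete_topology (U i)) I) ?T"
      using F x by (subst openin_PiE_gen) (auto elim: rev_finite_subset[of F] simp: PiE_iff)
    moreover have "x \<in> ?T"
      using x by (auto simp: PiE_iff)
    ultimately obtain a where a: "a \<in> A" "a \<in> ?T"
      using L unfolding in_closure_of by blast
    have "a i = x i" if "i \<in> F" for i
      using PiE_mem[OF a(2), of i] that F(2) by auto
    with a(1) show ?thesis by blast
  qed
  with x show ?R by blast
next
  assume R: ?R
  have "\<exists>a\<in>A. a \<in> T"
    if T: "x \<in> T" "openin (product_topology (\<lambda>i. discrete_topology (U i)) I) T" for T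
  proof -
    obtain V where V: "finite {i \<in> I. V i \<noteq> U i}" "x \<in> Pi\<^sub>E I V" "Pi\<^sub>E I V \<subseteq> T"
      using T by (force simp: openin_product_topology_alt)
    then obtain a where a: "a \<in> A" "\<forall>i\<in>{i \<in> I. V i \<noteq> U i}. a i = x i"
      using R by (metis (no_types, lifting) mem_Collect_eq subsetI)
    have "a \<in> Pi\<^sub>E I V"
    proof (rule PiE_I)
      show "a i \<in> V i" if "i \<in> I" for i
        using a V(2) that assms by (cases "V i = U i") (auto simp: PiE_iff)
      show "a i = undefined" if "i \<notin> I" for i
        using a(1) assms that by (auto simp: PiE_iff extensional_def)
    qed
    with a V(3) show ?thesis by blast
  qed
  moreover have "x \<in> topspace (product_topology (\<lambda>i. discrete_topology (U i)) I)"
    using R by simp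
  ultimately show ?L
    unfolding in_closure_of by blast
qed

section \<open>Shift dynamics\<close>

lemma closure_full_shift_iff:
  assumes A: "A \<subseteq> Pi UNIV (\<lambda>_. {0, 1})"
  shows "x \<in> full_shift closure_of A \<longleftrightarrow>
    range x \<subseteq> {0, 1} \<and> (\<forall>N. \<exists>a\<in>A. \<forall>n\<in>{-N..N}. a n = x n)"
proof -
  have "(\<forall>F. finite F \<longrightarrow> (\<exists>a\<in>A. \<forall>n\<in>F. a n = x n)) \<longleftrightarrow> (\<forall>N. \<exists>a\<in>A. \<forall>n\<in>{-N..N}. a n = x n)"
    (is "?L \<longleftrightarrow> ?R")
  proof
    assume R: ?R
    show ?L
    proof (intro allI impI)
      fix F :: "int set"
      assume F: "finite F"
      have "n \<in> {- Max (insert 0 (abs ` F))..Max (insert 0 (abs ` F))}" if "n \<in> F" for n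
      proof -
        have "\<bar>n\<bar> \<le> Max (insert 0 (abs ` F))"
          using F that by (intro Max_ge) auto
        then show ?thesis by auto
      qed
      then show "\<exists>a\<in>A. \<forall>n\<in>F. a n = x n"
        using R by blast
    qed
  qed simp
  moreover have "x \<in> Pi UNIV (\<lambda>_. {0, 1}) \<longleftrightarrow> range x \<subseteq> {0, 1}"
    by (simp add: Pi_iff image_subset_iff)
  ultimately show ?thesis
    using closure_of_product_discrete_iff[of A UNIV "\<lambda>_. {0, 1}" x] A
    unfolding full_shift_def PiE_UNIV_domain by simp
qed

lemma orbit_closure_iff:
  assumes "range x \<subseteq> {0, 1}"
  shows "y \<in> orbit_closure x \<longleftrightarrow>
    range y \<subseteq> {0, 1} \<and> (\<forall>N. \<exists>k. \<forall>n\<in>{-N..N}. x (n + k) = y n)"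
proof -
  have "range (\<lambda>k. shift_by k x) \<subseteq> Pi UNIV (\<lambda>_. {0, 1})"
    using assms by (simp add: shift_by_def image_subset_iff Pi_iff)
  then show ?thesis
    by (simp add: orbit_closure_def closure_full_shift_iff) (simp add: shift_by_def)
qed

lemma shift_by_mem_orbit_closure:
  assumes "range x \<subseteq> {0, 1}" "y \<in> orbit_closure x"
  shows "shift_by j y \<in> orbit_closure x"
  unfolding orbit_closure_iff[OF assms(1)]
proof (intro conjI allI)
  show "range (shift_by j y) \<subseteq> {0, 1}"
    using assms by (simp add: orbit_closure_iff shift_by_def image_subset_iff)
  fix N
  obtain k where k: "\<forall>n\<in>{-(\<bar>N\<bar> + \<bar>j\<bar>)..\<bar>N\<bar> + \<bar>j\<bar>}. x (n + k) = y n"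
    using assms(2) unfolding orbit_closure_iff[OF assms(1)] by blast
  have "x (n + (j + k)) = shift_by j y n" if "n \<in> {-N..N}" for n
  proof -
    have "n + j \<in> {-(\<bar>N\<bar> + \<bar>j\<bar>)..\<bar>N\<bar> + \<bar>j\<bar>}"
      using that by auto
    then have "x (n + j + k) = y (n + j)"
      using k by blast
    then show ?thesis by (simp add: shift_by_def add.assoc)
  qed
  then show "\<exists>k. \<forall>n\<in>{-N..N}. x (n + k) = shift_by j y n" by blast
qed

lemma closed_invariant_orbit_closure:
  assumes "range x \<subseteq> {0, 1}"
  shows "closed_invariant (orbit_closure x)"
proof -
  have "y \<in> left_shift ` orbit_closure x" if "y \<in> orbit_closure x" for y
  proof
    show "y = left_shift (shift_by (-1) y)"
      by (simp add: left_shift_def shift_by_def)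
  qed (use assms that in \<open>rule shift_by_mem_orbit_closure\<close>)
  then show ?thesis
    using shift_by_mem_orbit_closure[OF assms, of _ 1]
    by (auto simp: closed_invariant_def left_shift_def orbit_closure_def)
qed

lemma closed_invariant_shift_by:
  assumes Z: "closed_invariant Z" and "z \<in> Z"
  shows "shift_by k z \<in> Z"
proof -
  have shift_by_add: "shift_by i (shift_by j w) = shift_by (j + i) w" for i j and w :: "int \<Rightarrow> nat"
    by (simp add: shift_by_def algebra_simps)
  have inv: "shift_by 1 ` Z = Z"
    using Z by (simp add: closed_invariant_def left_shift_def)
  have up: "shift_by 1 w \<in> Z" if "w \<in> Z" for w
    using imageI[OF that, of "shift_by 1"] unfolding inv .
  have down: "shift_by (-1) w \<in> Z" if "w \<in> Z" for w
  proof -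
    have "w \<in> shift_by 1 ` Z"
      using that unfolding inv .
    then obtain v where v: "v \<in> Z" "w = shift_by 1 v"
      by (rule imageE)
    then have "shift_by (-1) w = v"
      by (simp add: shift_by_def)
    with v(1) show ?thesis by simp
  qed
  show ?thesis
  proof (induction k rule: int_induct[where k = 0])
    case base
    then show ?case using assms by (simp add: shift_by_def)
  next
    case (step1 i)
    then show ?case using up[of "shift_by i z"] by (simp add: shift_by_add)
  next
    case (step2 i)
    then show ?case using down[of "shift_by i z"] by (simp add: shift_by_add)
  qed
qed

lemma orbit_closure_subset:
  assumes "closed_invariant Z" "z \<in> Z"
  shows "orbit_closure z \<subseteq> Z"
  unfolding orbit_closure_def
  using assms closed_invariant_shift_by
  by (intro closure_of_minimal) (auto simp: closed_invariant_def)

text \<open>The last assumption puts \<open>e\<close>, and hence its orbit closure, into every non-empty closed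
  invariant subset of \<open>X\<close>, so the orbit closure of \<open>e\<close> is the least such subset.\<close>

lemma unique_minimal_subset_orbit_closure:
  assumes e: "range e \<subseteq> {0, 1}" and sub: "orbit_closure e \<subseteq> X"
    and X: "\<And>x. x \<in> X \<Longrightarrow> e \<in> orbit_closure x"
  shows "unique_minimal_subset X (orbit_closure e)"
proof -
  have least: "orbit_closure e \<subseteq> Z" if Z: "Z \<noteq> {}" "closed_invariant Z" "Z \<subseteq> X" for Z
  proof -
    obtain z where z: "z \<in> Z" using Z by blast
    then have "e \<in> Z"
      using X[of z] Z orbit_closure_subset[OF Z(2) z] by auto
    then show ?thesis
      by (rule orbit_closure_subset[OF Z(2)])
  qed
  have e_self: "e \<in> orbit_closure e"
    using e by (simp add: orbit_closure_iff exI[of _ 0])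
  moreover have "\<not> Z \<subset> orbit_closure e" if "Z \<noteq> {}" "closed_invariant Z" for Z
    using least[OF that] sub by blast
  ultimately have "minimal_subset X (orbit_closure e)"
    using sub closed_invariant_orbit_closure[OF e] unfolding minimal_subset_def by auto
  moreover have "Y = orbit_closure e" if Y: "minimal_subset X Y" for Y
  proof -
    have "orbit_closure e \<subseteq> Y"
      using Y by (intro least) (auto simp: minimal_subset_def)
    moreover have "\<not> orbit_closure e \<subset> Y"
      using Y e_self closed_invariant_orbit_closure[OF e] unfolding minimal_subset_def by auto
    ultimately show ?thesis by blast
  qed
  ultimately show ?thesis
    unfolding unique_minimal_subset_def by blast
qed

text \<open>The bound \<open>L\<close> on the place where a block of \<open>e\<close> occurs is what makes the property pass to
  limits: it is visible in the coordinates from \<open>- N\<close> to \<open>N + L\<close>.\<close>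

lemma orbit_closure_if_uniformly_visible:
  assumes A: "A \<subseteq> Pi UNIV (\<lambda>_. {0, 1})" and e: "range e \<subseteq> {0, 1}"
    and vis: "\<And>N. \<exists>L. \<forall>a\<in>A. \<exists>k\<in>{0..L}. \<forall>n\<in>{-N..N}. a (n + k) = e n"
    and x: "x \<in> full_shift closure_of A"
  shows "e \<in> orbit_closure x"
proof -
  have x01: "range x \<subseteq> {0, 1}"
    and near: "\<exists>a\<in>A. \<forall>n\<in>{-N..N}. a n = x n" for N
    using x unfolding closure_full_shift_iff[OF A] by simp_all
  have "\<exists>k. \<forall>n\<in>{-N..N}. x (n + k) = e n" for N
  proof -
    obtain L where L: "\<forall>a\<in>A. \<exists>k\<in>{0..L}. \<forall>n\<in>{-N..N}. a (n + k) = e n"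
      using vis by blast
    obtain a where a: "a \<in> A" "\<forall>n\<in>{-(\<bar>N\<bar> + \<bar>L\<bar>)..\<bar>N\<bar> + \<bar>L\<bar>}. a n = x n"
      using near by blast
    obtain k where k: "k \<in> {0..L}" "\<forall>n\<in>{-N..N}. a (n + k) = e n"
      using L a by blast
    have "x (n + k) = e n" if "n \<in> {-N..N}" for n
      using bspec[OF a(2), of "n + k"] k that by auto
    then show ?thesis by blast
  qed
  then show ?thesis
    using e by (simp add: orbit_closure_iff[OF x01])
qed

section \<open>The compact group and the coding function\<close>

lemma mem_H_group_iff:
  assumes "B \<subseteq> {1..}"
  shows "h \<in> H_group B \<longleftrightarrow> h \<in> (\<Pi>\<^sub>E b\<in>B. {0..<int b}) \<and>
    (\<forall>F. finite F \<and> F \<subseteq> B \<longrightarrow> (\<exists>m. \<forall>b\<in>F. m mod int b = h b))"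
proof -
  have carrier: "(\<Pi>\<^sub>E b\<in>B. carrier (integer_mod_group b)) = (\<Pi>\<^sub>E b\<in>B. {0..<int b})"
    using assms by (intro PiE_cong) (auto simp: carrier_integer_mod_group)
  have "range (diag B) \<subseteq> (\<Pi>\<^sub>E b\<in>B. carrier (integer_mod_group b))"
    unfolding carrier using assms by (force simp: diag_def)
  then have "h \<in> H_group B \<longleftrightarrow> h \<in> (\<Pi>\<^sub>E b\<in>B. {0..<int b}) \<and>
    (\<forall>F. finite F \<and> F \<subseteq> B \<longrightarrow> (\<exists>m. \<forall>b\<in>F. diag B m b = h b))"
    (is "_ \<longleftrightarrow> _ \<and> (\<forall>F. ?fin F \<longrightarrow> ?P F)")
    unfolding H_group_def residue_product_topology_def
    by (simp add: closure_of_product_discrete_iff carrier)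
  moreover have "?P F \<longleftrightarrow> (\<exists>m. \<forall>b\<in>F. m mod int b = h b)" if "?fin F" for F
    using that by (intro ex_cong1 ball_cong) (auto simp: diag_def)
  then have "(\<forall>F. ?fin F \<longrightarrow> ?P F) \<longleftrightarrow> (\<forall>F. ?fin F \<longrightarrow> (\<exists>m. \<forall>b\<in>F. m mod int b = h b))"
    by (intro all_cong)
  ultimately show ?thesis by (simp only:)
qed

lemma diag_mem_H_group:
  assumes "B \<subseteq> {1..}"
  shows "diag B m \<in> H_group B"
  unfolding mem_H_group_iff[OF assms]
proof (intro conjI allI impI)
  show "diag B m \<in> (\<Pi>\<^sub>E b\<in>B. {0..<int b})"
    using assms by (force simp: diag_def)
  show "\<exists>k. \<forall>b\<in>F. k mod int b = diag B m b" if "finite F \<and> F \<subseteq> B" for F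
    using that by (intro exI[of _ m]) (auto simp: diag_def)
qed

lemma residue_product_mult_diag:
  assumes "B \<subseteq> {1..}" "b \<in> B"
  shows "(h \<otimes>\<^bsub>residue_product B\<^esub> diag B n) b = (h b + n) mod int b"
  using assms by (simp add: product_group_def integer_mod_group_def diag_def mod_add_right_eq)

lemma translate_mem_H_group:
  assumes B: "B \<subseteq> {1..}" and h: "h \<in> H_group B"
  shows "h \<otimes>\<^bsub>residue_product B\<^esub> diag B n \<in> H_group B"
  unfolding mem_H_group_iff[OF B]
proof (intro conjI allI impI)
  show "h \<otimes>\<^bsub>residue_product B\<^esub> diag B n \<in> (\<Pi>\<^sub>E b\<in>B. {0..<int b})"
  proof (rule PiE_I)
    show "(h \<otimes>\<^bsub>residue_product B\<^esub> diag B n) b \<in> {0..<int b}" if "b \<in> B" for b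
      using that B by (auto simp: residue_product_mult_diag[OF B])
  qed (simp add: product_group_def)
  fix F
  assume F: "finite F \<and> F \<subseteq> B"
  then obtain m where m: "\<forall>b\<in>F. m mod int b = h b"
    using h unfolding mem_H_group_iff[OF B] by blast
  have "(m + n) mod int b = (h \<otimes>\<^bsub>residue_product B\<^esub> diag B n) b" if "b \<in> F" for b
  proof -
    have "(m + n) mod int b = (m mod int b + n) mod int b"
      by (simp add: mod_add_left_eq)
    moreover have "b \<in> B" "m mod int b = h b"
      using that F m by auto
    ultimately show ?thesis
      by (simp only: residue_product_mult_diag[OF B])
  qed
  then show "\<exists>m. \<forall>b\<in>F. m mod int b = (h \<otimes>\<^bsub>residue_product B\<^esub> diag B n) b" by blast
qed

lemma coding_eq:
  assumes B: "B \<subseteq> {1..}" and h: "h \<in> H_group B"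
  shows "coding B h n = (if \<exists>b\<in>B. int b dvd h b + n then 0 else 1)"
proof -
  have "h \<otimes>\<^bsub>residue_product B\<^esub> diag B n \<in> window B \<longleftrightarrow> \<not> (\<exists>b\<in>B. int b dvd h b + n)"
    using translate_mem_H_group[OF assms] residue_product_mult_diag[OF B]
    unfolding window_def dvd_eq_mod_eq_0 by fastforce
  then show ?thesis by (simp add: coding_def)
qed

lemma coding_in_01: "coding B h n \<in> {0, 1}"
  by (simp add: coding_def)

lemma coding_diag:
  assumes "B \<subseteq> {1..}"
  shows "coding B (diag B m) = shift_by m (coding B (diag B 0))"
proof
  fix n
  have "int b dvd diag B m b + n \<longleftrightarrow> int b dvd diag B 0 b + (n + m)" if "b \<in> B" for b
    using that by (simp add: diag_def dvd_eq_mod_eq_0 mod_add_left_eq add.commute[of n])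
  then show "coding B (diag B m) n = shift_by m (coding B (diag B 0)) n"
    by (simp add: coding_eq[OF assms diag_mem_H_group[OF assms]] shift_by_def cong: bex_cong)
qed

lemma X_eta_eq_orbit_closure:
  assumes "B \<subseteq> {1..}"
  shows "X_eta B = orbit_closure (coding B (diag B 0))"
proof -
  have "coding B \<circ> diag B = (\<lambda>k. shift_by k (coding B (diag B 0)))"
    using coding_diag[OF assms] by (simp add: fun_eq_iff)
  then show ?thesis
    by (simp add: X_eta_def orbit_closure_def image_comp)
qed

text \<open>Although \<open>h\<close> need not be a diagonal point, any two of its residues are consistent, and so
  are the one modulo \<open>b\<close> and those modulo the elements of a finite set.\<close>

lemma gcd_Lcm_dvd_coordinate:
  assumes B: "B \<subseteq> {1..}" and h: "h \<in> H_group B"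
    and S: "finite S" "S \<subseteq> B" and b: "b \<in> B"
    and k: "\<forall>s\<in>S. int s dvd h s + k"
  shows "int (gcd b (Lcm S)) dvd h b + k"
proof -
  have "finite (insert b S) \<and> insert b S \<subseteq> B"
    using S b by simp
  then obtain m where m: "\<forall>s\<in>insert b S. m mod int s = h s"
    using h unfolding mem_H_group_iff[OF B] by blast
  have cong: "int s dvd h s + k \<longleftrightarrow> int s dvd m + k" if "s \<in> insert b S" for s
  proof -
    have "h s = m mod int s"
      using m that by (blast intro: sym)
    then show ?thesis by (simp add: dvd_eq_mod_eq_0 mod_add_left_eq)
  qed
  have "Lcm S dvd nat \<bar>m + k\<bar>"
    using k cong by (intro Lcm_least) (simp add: dvd_nat_abs_iff)
  then have "int (gcd b (Lcm S)) dvd m + k"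
    by (metis dvd_nat_abs_iff dvd_trans gcd_dvd2)
  moreover have "int b dvd m - h b"
    using m by (metis insertI1 minus_mod_eq_mult_div dvd_triv_left)
  then have "int (gcd b (Lcm S)) dvd m - h b"
    by (meson dvd_trans gcd_dvd1 of_nat_dvd_iff)
  ultimately have "int (gcd b (Lcm S)) dvd (m + k) - (m - h b)"
    by (rule dvd_diff)
  then show ?thesis by (simp add: algebra_simps)
qed

section \<open>The complement of \<open>E\<close>\<close>

lemma mem_E_set_iff:
  "n \<in> E_set B \<longleftrightarrow>
    (\<exists>S. S \<subseteq> B \<and> finite S \<and> (\<forall>b\<in>B. \<not> int (gcd b (Lcm S)) dvd n))"
  by (auto simp: E_set_def free_set_def multiples_def gcd_set_def dvd_def)

lemma gcd_Lcm_dvd_mono: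
  fixes S T :: "nat set"
  assumes "S \<subseteq> T"
  shows "gcd b (Lcm S) dvd gcd b (Lcm T)"
  using assms by (intro gcd_mono dvd_refl Lcm_least dvd_Lcm) auto

text \<open>For \<open>n \<noteq> 0\<close> only finitely many \<open>c\<close> divide \<open>n\<close>. If for each of them some finite \<open>T c\<close> made
  \<open>gcd b (Lcm (T c)) dvd c\<close> impossible, then, with \<open>U\<close> the union of all \<open>T c\<close>, no \<open>gcd b (Lcm U)\<close>
  could divide \<open>n\<close>, for it would itself be such a \<open>c\<close>; this would put \<open>n\<close> into \<open>E\<close>.
  For \<open>n = 0\<close> any element of \<open>B\<close> serves as \<open>c\<close>.\<close>

lemma persistent_divisor_of_non_E:
  assumes "B \<noteq> {}" and n: "n \<notin> E_set B"
  shows "\<exists>c. int c dvd n \<and> (\<exists>S. finite S \<and> S \<subseteq> B \<and> c dvd Lcm S) \<and>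
    (\<forall>T. finite T \<and> T \<subseteq> B \<longrightarrow> (\<exists>b\<in>B. gcd b (Lcm T) dvd c))"
proof (cases "n = 0")
  case True
  obtain b where "b \<in> B" using assms by blast
  then show ?thesis
    using True by (intro exI[of _ b] conjI exI[of _ "{b}"]) auto
next
  case False
  define D where "D = {c. int c dvd n \<and> (\<exists>S. finite S \<and> S \<subseteq> B \<and> c dvd Lcm S)}"
  have "finite {c. c dvd nat \<bar>n\<bar>}"
    by (rule finite_divisors_nat) (use False in simp)
  then have "finite D"
    unfolding dvd_nat_abs_iff by (rule rev_finite_subset) (auto simp: D_def)
  show ?thesis
  proof (rule ccontr)
    assume contra: "\<not> ?thesis"
    have "\<exists>T. finite T \<and> T \<subseteq> B \<and> (\<forall>b\<in>B. \<not> gcd b (Lcm T) dvd c)" if "c \<in> D" for c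
    proof (rule ccontr)
      assume "\<not> ?thesis"
      then have "\<forall>T. finite T \<and> T \<subseteq> B \<longrightarrow> (\<exists>b\<in>B. gcd b (Lcm T) dvd c)"
        by metis
      with contra that show False
        unfolding D_def mem_Collect_eq by (metis (no_types, lifting))
    qed
    then obtain T where T: "\<And>c. c \<in> D \<Longrightarrow> finite (T c) \<and> T c \<subseteq> B"
      and excl: "\<And>c b. \<lbrakk>c \<in> D; b \<in> B\<rbrakk> \<Longrightarrow> \<not> gcd b (Lcm (T c)) dvd c"
      by metis
    define U where "U = (\<Union>c\<in>D. T c)"
    have U: "finite U" "U \<subseteq> B"
      using T \<open>finite D\<close> by (auto simp: U_def)
    then obtain b where b: "b \<in> B" "int (gcd b (Lcm U)) dvd n"
      using n unfolding mem_E_set_iff by blast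
    let ?c = "gcd b (Lcm U)"
    have c: "?c \<in> D"
      unfolding D_def mem_Collect_eq using b(2) U gcd_dvd2 by blast
    have "gcd b (Lcm (T ?c)) dvd ?c"
      using c by (intro gcd_Lcm_dvd_mono) (auto simp: U_def)
    with excl[OF c b(1)] show False ..
  qed
qed

section \<open>Simultaneous congruences\<close>

lemma simultaneous_congruence:
  fixes k a p q :: int
  assumes "gcd p q dvd k + a"
  obtains k' where "q dvd k' - k" "p dvd k' + a"
proof -
  obtain u v where uv: "u * p + v * q = gcd p q"
    using bezout_int by blast
  obtain t where t: "k + a = gcd p q * t"
    using assms by (auto simp: dvd_def)
  show ?thesis
  proof
    show "q dvd (k - v * t * q) - k" by simp
    have "(k - v * t * q) + a = p * (u * t)"
      using t uv by algebra
    then show "p dvd (k - v * t * q) + a" by simp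
  qed
qed

text \<open>The zeros are created one after the other. The new congruence modulo \<open>b\<close> is compatible with
  the old ones modulo the elements of \<open>S\<close>, because \<open>gcd b (Lcm S)\<close> divides a number \<open>c\<close> that was
  already a divisor of \<open>Lcm S\<^sub>0\<close>: hence it divides \<open>h b + k\<close>, for which the normalisation modulo
  \<open>S\<^sub>0\<close> is enough, and it divides \<open>n\<close>. The set \<open>S\<close> is the same for all \<open>h\<close>.\<close>

lemma prescribe_zeros:
  assumes B: "B \<subseteq> {1..}" and S0: "finite S\<^sub>0" "S\<^sub>0 \<subseteq> B" and "finite T"
    and c: "\<And>n. n \<in> T \<Longrightarrow> int (c n) dvd n \<and> c n dvd Lcm S\<^sub>0"
    and persistent: "\<And>n S. \<lbrakk>n \<in> T; finite S; S \<subseteq> B\<rbrakk> \<Longrightarrow> \<exists>b\<in>B. gcd b (Lcm S) dvd c n"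
  shows "\<exists>S. finite S \<and> S\<^sub>0 \<subseteq> S \<and> S \<subseteq> B \<and>
    (\<forall>h\<in>H_group B. \<exists>k. (\<forall>s\<in>S\<^sub>0. int s dvd h s + k) \<and>
      (\<forall>n\<in>T. \<exists>s\<in>S. int s dvd h s + (n + k)))"
  using \<open>finite T\<close> c persistent
proof (induction T)
  case empty
  have "\<exists>k. \<forall>s\<in>S\<^sub>0. int s dvd h s + k" if h: "h \<in> H_group B" for h
  proof -
    obtain m where m: "\<forall>s\<in>S\<^sub>0. m mod int s = h s"
      using h S0 unfolding mem_H_group_iff[OF B] by blast
    have "int s dvd h s + (- m)" if "s \<in> S\<^sub>0" for s
      using m that by (metis add_uminus_conv_diff dvd_minus_mod dvd_diff_commute)
    then show ?thesis by blast
  qed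
  then show ?case using S0 by auto
next
  case (insert n T)
  have "\<exists>S. finite S \<and> S\<^sub>0 \<subseteq> S \<and> S \<subseteq> B \<and>
    (\<forall>h\<in>H_group B. \<exists>k. (\<forall>s\<in>S\<^sub>0. int s dvd h s + k) \<and>
      (\<forall>n\<in>T. \<exists>s\<in>S. int s dvd h s + (n + k)))"
    using insert.prems by (intro insert.IH) auto
  then obtain S where S: "finite S" "S\<^sub>0 \<subseteq> S" "S \<subseteq> B"
    and IH: "\<And>h. h \<in> H_group B \<Longrightarrow> \<exists>k. (\<forall>s\<in>S\<^sub>0. int s dvd h s + k) \<and>
      (\<forall>n\<in>T. \<exists>s\<in>S. int s dvd h s + (n + k))"
    by blast
  obtain b where b: "b \<in> B" "gcd b (Lcm S) dvd c n"
    using insert.prems(2)[of n S] S by auto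
  let ?g = "gcd b (Lcm S)"
  have g: "int ?g dvd n" "?g dvd gcd b (Lcm S\<^sub>0)"
    using b insert.prems(1)[of n] by (auto intro: dvd_trans of_nat_dvd_iff[THEN iffD2])
  have "\<exists>k. (\<forall>s\<in>S\<^sub>0. int s dvd h s + k) \<and>
      (\<forall>m\<in>insert n T. \<exists>s\<in>insert b S. int s dvd h s + (m + k))" if h: "h \<in> H_group B" for h
  proof -
    obtain k where k: "\<forall>s\<in>S\<^sub>0. int s dvd h s + k"
      and kT: "\<forall>m\<in>T. \<exists>s\<in>S. int s dvd h s + (m + k)"
      using IH[OF h] by blast
    have "int (gcd b (Lcm S\<^sub>0)) dvd h b + k"
      using gcd_Lcm_dvd_coordinate[OF B h S0 b(1) k] .
    then have "int ?g dvd h b + k"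
      using g(2) by (meson dvd_trans of_nat_dvd_iff)
    then have "int ?g dvd (h b + k) + n"
      using g(1) by (rule dvd_add)
    then have "gcd (int b) (int (Lcm S)) dvd k + (h b + n)"
      by (simp add: gcd_int_int_eq algebra_simps)
    then obtain k' where k': "int (Lcm S) dvd k' - k" "int b dvd k' + (h b + n)"
      by (rule simultaneous_congruence)
    have keep: "int s dvd h s + (m + k')" if "s \<in> S" "int s dvd h s + (m + k)" for s m
    proof -
      have "int s dvd k' - k"
        using k'(1) that(1) by (meson dvd_Lcm dvd_trans of_nat_dvd_iff)
      then have "int s dvd (h s + (m + k)) + (k' - k)"
        using that(2) by (simp only: dvd_add)
      then show ?thesis by (simp add: algebra_simps)
    qed
    have "\<forall>s\<in>S\<^sub>0. int s dvd h s + k'"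
      using k keep[of _ 0] S(2) by auto
    moreover have "int b dvd h b + (n + k')"
      using k'(2) by (simp add: algebra_simps)
    then have "\<exists>s\<in>insert b S. int s dvd h s + (m + k')" if "m \<in> insert n T" for m
      using that kT keep by blast
    ultimately show ?thesis by blast
  qed
  then show ?case
    using S b(1) by (intro exI[of _ "insert b S"]) auto
qed

section \<open>Every coded point shows every block of \<open>E\<close>\<close>

lemma common_finite_subset_if_mono:
  assumes "finite J" "\<And>j S T. \<lbrakk>j \<in> J; P j S; S \<subseteq> T; finite T; T \<subseteq> B\<rbrakk> \<Longrightarrow> P j T"
    and "\<And>j. j \<in> J \<Longrightarrow> \<exists>S. finite S \<and> S \<subseteq> B \<and> P j S"
  shows "\<exists>S. finite S \<and> S \<subseteq> B \<and> (\<forall>j\<in>J. P j S)"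
proof -
  obtain F where F: "\<And>j. j \<in> J \<Longrightarrow> finite (F j) \<and> F j \<subseteq> B \<and> P j (F j)"
    using assms(3) by metis
  show ?thesis
  proof (intro exI conjI ballI)
    show U: "finite (\<Union>j\<in>J. F j)" "(\<Union>j\<in>J. F j) \<subseteq> B"
      using F assms(1) by blast+
    show "P j (\<Union>j\<in>J. F j)" if "j \<in> J" for j
    proof (rule assms(2)[OF that _ _ U])
      show "P j (F j)" using F[OF that] by blast
    qed (use that in blast)
  qed
qed

lemma E_block_uniformly_visible:
  assumes B: "B \<subseteq> {1..}" and "B \<noteq> {}"
  shows "\<exists>L. \<forall>h\<in>H_group B. \<exists>k\<in>{0..L}. \<forall>n\<in>{-N..N}.
    coding B h (n + k) = indicator (E_set B) n"
proof -
  let ?Q = "\<lambda>n c. int c dvd n \<and> (\<exists>S. finite S \<and> S \<subseteq> B \<and> c dvd Lcm S) \<and>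
    (\<forall>T. finite T \<and> T \<subseteq> B \<longrightarrow> (\<exists>b\<in>B. gcd b (Lcm T) dvd c))"
  have "\<forall>n. \<exists>c. n \<notin> E_set B \<longrightarrow> ?Q n c"
    using persistent_divisor_of_non_E[OF \<open>B \<noteq> {}\<close>] by simp
  then obtain c where cQ: "\<forall>n. n \<notin> E_set B \<longrightarrow> ?Q n (c n)"
    by (rule choice[THEN exE])
  have c: "int (c n) dvd n" if "n \<notin> E_set B" for n
    using cQ that by blast
  have cS: "\<exists>S. finite S \<and> S \<subseteq> B \<and> c n dvd Lcm S" if "n \<notin> E_set B" for n
    using cQ that by blast
  have persistent: "\<exists>b\<in>B. gcd b (Lcm S) dvd c n" if "n \<notin> E_set B" "finite S" "S \<subseteq> B" for n S
    using cQ that by blast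
  \<comment> \<open>\<open>P n S\<close> says that \<open>S\<close> is large enough to treat the position \<open>n\<close>: it certifies \<open>n \<in> E\<close>, or it
    absorbs the divisor \<open>c n\<close> that is needed to place a zero at \<open>n\<close>.\<close>
  define P where "P n S \<longleftrightarrow> (if n \<in> E_set B then \<forall>b\<in>B. \<not> int (gcd b (Lcm S)) dvd n
    else c n dvd Lcm S)" for n S
  have P_ex: "\<exists>S. finite S \<and> S \<subseteq> B \<and> P n S" for n
  proof (cases "n \<in> E_set B")
    case True
    then show ?thesis
      unfolding P_def if_P[OF True] unfolding mem_E_set_iff by blast
  next
    case False
    then show ?thesis
      using cS unfolding P_def if_not_P[OF False] by blast
  qed
  have P_mono: "P n T" if "P n S" "S \<subseteq> T" for n S T
  proof -
    have "int (gcd b (Lcm S)) dvd int (gcd b (Lcm T))" for b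
      using gcd_Lcm_dvd_mono[OF that(2)] by (simp only: of_nat_dvd_iff)
    moreover have "Lcm S dvd Lcm T"
      using that(2) by (intro Lcm_least dvd_Lcm) auto
    ultimately show ?thesis
      using that(1) unfolding P_def by (metis dvd_trans)
  qed
  have "\<exists>S. finite S \<and> S \<subseteq> B \<and> (\<forall>n\<in>{-N..N}. P n S)"
    by (rule common_finite_subset_if_mono[OF finite_atLeastAtMost_int P_mono P_ex])
  then obtain S0 where S0: "finite S0" "S0 \<subseteq> B" and P: "\<And>n. n \<in> {-N..N} \<Longrightarrow> P n S0"
    by (elim exE conjE) simp
  have "\<exists>S. finite S \<and> S0 \<subseteq> S \<and> S \<subseteq> B \<and>
    (\<forall>h\<in>H_group B. \<exists>k. (\<forall>s\<in>S0. int s dvd h s + k) \<and>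
      (\<forall>n\<in>{-N..N} - E_set B. \<exists>s\<in>S. int s dvd h s + (n + k)))"
  proof (rule prescribe_zeros[OF B S0])
    show "int (c n) dvd n \<and> c n dvd Lcm S0" if "n \<in> {-N..N} - E_set B" for n
      using that P[of n] c by (auto simp: P_def)
  qed (use persistent in auto)
  then obtain S where S: "finite S" "S0 \<subseteq> S" "S \<subseteq> B"
    and zeros: "\<And>h. h \<in> H_group B \<Longrightarrow> \<exists>k. (\<forall>s\<in>S0. int s dvd h s + k) \<and>
      (\<forall>n\<in>{-N..N} - E_set B. \<exists>s\<in>S. int s dvd h s + (n + k))"
    by blast
  have "0 \<notin> S"
    using S(3) B by force
  then have pos: "int (Lcm S) > 0"
    using S(1) by (simp add: Lcm_0_iff flip: neq0_conv)
  have "\<exists>k\<in>{0..int (Lcm S)}. \<forall>n\<in>{-N..N}. coding B h (n + k) = indicator (E_set B) n"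
    if h: "h \<in> H_group B" for h
  proof -
    obtain k' where k': "\<forall>s\<in>S0. int s dvd h s + k'"
      "\<forall>n\<in>{-N..N} - E_set B. \<exists>s\<in>S. int s dvd h s + (n + k')"
      using zeros[OF h] by blast
    \<comment> \<open>All conditions on \<open>k'\<close> are congruences modulo elements of \<open>S\<close>, which does not depend on
      \<open>h\<close>; hence the reduction modulo \<open>Lcm S\<close> gives the uniform bound.\<close>
    define k where "k = k' mod int (Lcm S)"
    have red: "int s dvd h s + (n + k)" if "s \<in> S" "int s dvd h s + (n + k')" for s n
    proof -
      have "int s dvd k' - k"
        unfolding k_def using that(1) by (meson dvd_Lcm dvd_minus_mod dvd_trans of_nat_dvd_iff)
      then have "int s dvd (h s + (n + k')) - (k' - k)"
        using that(2) by (simp only: dvd_diff)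
      then show ?thesis by (simp add: algebra_simps)
    qed
    have k: "\<forall>s\<in>S0. int s dvd h s + k"
      using k'(1) red[of _ 0] S(2) by auto
    have "coding B h (n + k) = indicator (E_set B) n" if n: "n \<in> {-N..N}" for n
    proof (cases "n \<in> E_set B")
      case True
      have "\<not> int b dvd h b + (n + k)" if b: "b \<in> B" for b
      proof
        assume "int b dvd h b + (n + k)"
        then have "int (gcd b (Lcm S0)) dvd h b + (n + k)"
          by (meson dvd_trans gcd_dvd1 of_nat_dvd_iff)
        moreover have "int (gcd b (Lcm S0)) dvd h b + k"
          using gcd_Lcm_dvd_coordinate[OF B h S0 b k] .
        ultimately have "int (gcd b (Lcm S0)) dvd (h b + (n + k)) - (h b + k)"
          by (rule dvd_diff)
        then show False
          using P[OF n] True b by (simp add: P_def)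
      qed
      then show ?thesis
        using True by (simp add: coding_eq[OF B h])
    next
      case False
      then have "\<exists>b\<in>B. int b dvd h b + (n + k)"
        using k'(2) red n S(3) by blast
      then show ?thesis
        using False by (simp add: coding_eq[OF B h])
    qed
    moreover have "k \<in> {0..int (Lcm S)}"
      using pos by (simp add: k_def less_imp_le)
    ultimately show ?thesis by blast
  qed
  then show ?thesis by blast
qed

section \<open>The unique minimal subset\<close>

theorem corollary5:
  fixes B :: "nat set"
  assumes "B \<subseteq> {1..}" and "B \<noteq> {}" and "primitive B"
  shows "unique_minimal_subset (X_phi B) (X_E B) \<and> unique_minimal_subset (X_eta B) (X_E B)"
proof -
  let ?e = "indicator (E_set B) :: int \<Rightarrow> nat"
  let ?eta = "coding B (diag B 0)"
  have e: "range ?e \<subseteq> {0, 1}"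
    by (auto simp: indicator_def)
  have e_in: "?e \<in> orbit_closure x" if "x \<in> X_phi B" for x
  proof (rule orbit_closure_if_uniformly_visible)
    show "coding B ` H_group B \<subseteq> Pi UNIV (\<lambda>_. {0, 1})"
      unfolding image_subset_iff Pi_iff using coding_in_01 by blast
    show "x \<in> full_shift closure_of (coding B ` H_group B)"
      using that by (simp add: X_phi_def)
    show "\<exists>L. \<forall>a\<in>coding B ` H_group B. \<exists>k\<in>{0..L}. \<forall>n\<in>{-N..N}. a (n + k) = ?e n" for N
      unfolding ball_simps by (rule E_block_uniformly_visible[OF assms(1,2)])
  qed (rule e)
  have eta: "range ?eta \<subseteq> {0, 1}"
    unfolding image_subset_iff using coding_in_01 by blast
  have sub: "X_eta B \<subseteq> X_phi B"
    unfolding X_eta_def X_phi_def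
    using diag_mem_H_group[OF assms(1)] by (intro closure_of_mono) auto
  have "?eta \<in> X_eta B"
    using eta by (simp add: X_eta_eq_orbit_closure[OF assms(1)] orbit_closure_iff exI[of _ 0])
  then have "?e \<in> X_eta B"
    using sub e_in X_eta_eq_orbit_closure[OF assms(1)] by blast
  then have "X_E B \<subseteq> X_eta B"
    unfolding X_E_def X_eta_eq_orbit_closure[OF assms(1)]
    using closed_invariant_orbit_closure[OF eta] by (intro orbit_closure_subset)
  with sub e_in show ?thesis
    unfolding X_E_def by (intro conjI unique_minimal_subset_orbit_closure[OF e]) auto
qed

end
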